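(* Let $n,k\ge 1$, let $\mathbf{S}\subseteq\mathbf{T}(n,k)$ be closed under rotations, and let $\alpha,\beta\in\mathbf{S}$. Then $\beta$ is a substring of $\mathit{Greedy}_\alpha(\mathbf{S})$, viewed as a cyclic string, if and only if $\beta$ is increasable in $\mathbf{S}$ to a rotation of $\alpha$. Consequently, if $\mathbf{S}\subseteq\mathbf{T}(n,k)$ is nonempty and closed under rotations, then there exists $\alpha\in\mathbf{S}$ such that $\mathit{Greedy}_\alpha(\mathbf{S})$ is a universal cycle for $\mathbf{S}$ if and only if there exists $\alpha\in\mathbf{S}$ such that every $\beta\in\mathbf{S}$ is increasable in $\mathbf{S}$ to $\alpha$.
   Context: $\mathbf{T}(n,k)$ is the set of strings of length $n$ over the alphabet $\{1,2,\ldots,k\}$. A rotation of a string $b_1\cdots b_n$ is any cyclic shift $b_{i+1}\cdots b_nb_1\cdots b_i$; $\mathbf{S}$ is closed under rotations if every rotation of an element of $\mathbf{S}$ lies in $\mathbf{S}$. Greedy construction: for $\alpha\in\mathbf{S}$, put $\beta_0=\alpha$. Having defined $\beta_0,\ldots,\beta_j$ with $\beta_j=a\gamma$ ($a$ a symbol, $\gamma$ of length $n-1$), let $a_{j+1}$ be the least symbol $c\in\{1,\ldots,k\}$ such that $\gamma c\in\mathbf{S}$ and $\gamma c\ne\beta_i$ for all $1\le i\le j$, and put $\beta_{j+1}=\gamma a_{j+1}$. The process halts at the first $\beta_m$ such that either $\beta_m=\alpha$ (with $m\ge1$), or no such symbol exists. Let $m$ be the largest index reached; define $\mathit{Greedy}_\alpha(\mathbf{S})=a_1a_2\cdots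 a_m$. The length-$n$ substrings of this string, viewed cyclically, are the strings considered. A universal cycle for $\mathbf{S}$ is a string of length $|\mathbf{S}|$ in which, viewed as a cycle, every element of $\mathbf{S}$ occurs exactly once as a length-$n$ substring; $\mathit{Greedy}_\alpha(\mathbf{S})$ is a universal cycle for $\mathbf{S}$ when its length-$n$ suffix is $\alpha$ and every element of $\mathbf{S}$ is a cyclic substring of it. For $\alpha,\beta\in\mathbf{S}$, $\beta$ is increasable in $\mathbf{S}$ to $\alpha$ if there is a sequence $\beta=\delta_0,\delta_1,\ldots,\delta_t=\alpha$ ($t\ge0$) of elements of $\mathbf{S}$ such that each $\delta_{i+1}$ is obtained from $\delta_i$ by strictly increasing exactly one symbol (in particular every $\alpha\in\mathbf{S}$ is increasable in $\mathbf{S}$ to itself).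
   Formalization: In the "Consequently" part, "increasable in S to α" is replaced by "increasable in S to a rotation of α"; as written the equivalence fails, e.g. for S={12,21}, where Greedy_12(S)=12 is a universal cycle but neither string is increasable to the other. *)

theory Defs
  imports Main
begin

definition strings :: "nat \<Rightarrow> nat \<Rightarrow> nat list set" where
  "strings n k = {w. length w = n \<and> set w \<subseteq> {1..k}}"

definition rotations :: "'a list \<Rightarrow> 'a list set" where
  "rotations w = {rotate i w | i. True}"

definition closed_under_rotations :: "'a list set \<Rightarrow> bool" where
  "closed_under_rotations S \<longleftrightarrow> (\<forall>w \<in> S. rotations w \<subseteq> S)"

text \<open>
  A list \<open>bs = [b\<^sub>0, b\<^sub>1, \<dots>, b\<^sub>j]\<close> is the history of the greedy construction started at
  \<open>b\<^sub>0\<close>. The starting string itself is not excluded from being visited again, hence \<open>tl bs\<close>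
  in the next definition.
\<close>

definition greedy_choices :: "nat \<Rightarrow> nat list set \<Rightarrow> nat list list \<Rightarrow> nat set" where
  "greedy_choices k S bs =
     {c \<in> {1..k}. tl (last bs) @ [c] \<in> S \<and> tl (last bs) @ [c] \<notin> set (tl bs)}"

definition greedy_halted :: "nat \<Rightarrow> nat list set \<Rightarrow> nat list list \<Rightarrow> bool" where
  "greedy_halted k S bs \<longleftrightarrow>
     (length bs \<ge> 2 \<and> last bs = hd bs) \<or> greedy_choices k S bs = {}"

definition greedy_step :: "nat \<Rightarrow> nat list set \<Rightarrow> nat list list \<Rightarrow> nat list list" where
  "greedy_step k S bs = bs @ [tl (last bs) @ [LEAST c. c \<in> greedy_choices k S bs]]"

text \<open>
  \<open>greedy_run k S a j\<close> is a history of length \<open>j + 1\<close>; it is meaningful as long as no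
  earlier history has halted, and \<open>greedy\<close> uses it only up to the first halting index.
\<close>

primrec greedy_run :: "nat \<Rightarrow> nat list set \<Rightarrow> nat list \<Rightarrow> nat \<Rightarrow> nat list list" where
  "greedy_run k S a 0 = [a]"
| "greedy_run k S a (Suc j) = greedy_step k S (greedy_run k S a j)"

definition greedy :: "nat \<Rightarrow> nat list set \<Rightarrow> nat list \<Rightarrow> nat list" where
  "greedy k S a =
     map last (tl (greedy_run k S a (LEAST m. greedy_halted k S (greedy_run k S a m))))"

text \<open>
  Indices are read modulo \<open>length w\<close>, so a window may wrap around several times when
  \<open>length w < n\<close>; for example, \<open>[1]\<close> is a universal cycle for \<open>{[1,1,1]}\<close>.
\<close>

definition cyclic_window :: "nat \<Rightarrow> 'a list \<Rightarrow> nat \<Rightarrow> 'a list" where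
  "cyclic_window n w i = map (\<lambda>j. w ! ((i + j) mod length w)) [0..<n]"

definition cyclic_substring :: "'a list \<Rightarrow> 'a list \<Rightarrow> bool" where
  "cyclic_substring b w \<longleftrightarrow> (\<exists>i < length w. cyclic_window (length b) w i = b)"

definition universal_cycle :: "nat \<Rightarrow> 'a list set \<Rightarrow> 'a list \<Rightarrow> bool" where
  "universal_cycle n S w \<longleftrightarrow>
     length w = card S \<and> (\<forall>b \<in> S. \<exists>!i. i < length w \<and> cyclic_window n w i = b)"

definition increases_one :: "nat list \<Rightarrow> nat list \<Rightarrow> bool" where
  "increases_one d e \<longleftrightarrow> (\<exists>i < length d. \<exists>c > d ! i. e = d[i := c])"

definition increasable :: "nat list set \<Rightarrow> nat list \<Rightarrow> nat list \<Rightarrow> bool" where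
  "increasable S b a \<longleftrightarrow> b \<in> S \<and> (\<lambda>d e. e \<in> S \<and> increases_one d e)\<^sup>*\<^sup>* b a"

text \<open>
  A greedy universal cycle exists for the rotation class \<open>{12, 21}\<close>, although neither of the
  two strings can be increased to the other: increasability of all strings to a single string,
  rather than to its rotations, is not necessary for the existence of a greedy universal cycle.
\<close>

lemma greedy_universal_cycle_without_common_bound:
  defines "S \<equiv> {[1, 2], [2, 1 :: nat]}"
  shows "S \<subseteq> strings 2 2" "closed_under_rotations S"
    "\<exists>a \<in> S. universal_cycle 2 S (greedy 2 S a)"
    "\<not> (\<exists>a \<in> S. \<forall>b \<in> S. increasable S b a)"
proof -
  show "S \<subseteq> strings 2 2" by (auto simp: S_def strings_def)
  have rot: "rotate i w \<in> S" if "w \<in> S" for i w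
    using that by (induction i) (auto simp: S_def)
  then show "closed_under_rotations S"
    by (auto simp: closed_under_rotations_def rotations_def)
  have least: "(LEAST c. c = x) = x" for x :: nat
    by (rule Least_equality) auto
  have c0: "greedy_choices 2 S [[1, 2]] = {1}"
    by (auto simp: greedy_choices_def S_def)
  have c1: "greedy_choices 2 S [[1, 2], [2, 1]] = {2}"
    by (auto simp: greedy_choices_def S_def)
  have r1: "greedy_run 2 S [1, 2] (Suc 0) = [[1, 2], [2, 1]]"
    using c0 by (simp add: greedy_step_def least)
  have r2: "greedy_run 2 S [1, 2] (Suc (Suc 0)) = [[1, 2], [2, 1], [1, 2]]"
    using c1 r1 by (simp add: greedy_step_def least)
  have "(LEAST m. greedy_halted 2 S (greedy_run 2 S [1, 2] m)) = Suc (Suc 0)"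
  proof (rule Least_equality)
    show "greedy_halted 2 S (greedy_run 2 S [1, 2] (Suc (Suc 0)))"
      unfolding r2 by (simp add: greedy_halted_def)
    fix m assume m: "greedy_halted 2 S (greedy_run 2 S [1, 2] m)"
    have "m \<noteq> 0" using m c0 by (intro notI) (simp add: greedy_halted_def)
    moreover have "m \<noteq> Suc 0"
      using m r1 c1 by (intro notI) (simp add: greedy_halted_def del: greedy_run.simps)
    ultimately show "Suc (Suc 0) \<le> m" by simp
  qed
  then have g: "greedy 2 S [1, 2] = [1, 2]"
    unfolding greedy_def using r2 by (simp del: greedy_run.simps)
  have "universal_cycle 2 S [1, 2]"
    by (auto simp: universal_cycle_def S_def cyclic_window_def upt_rec less_Suc_eq)
  then show "\<exists>a \<in> S. universal_cycle 2 S (greedy 2 S a)"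
    using g by (intro bexI[of _ "[1, 2]"]) (auto simp: S_def)
  have stuck: "\<not> (e \<in> S \<and> increases_one d e)" if "d \<in> S" for d e
    using that by (auto simp: S_def increases_one_def less_Suc_eq)
  have "b = a" if "increasable S b a" for a b
    using that stuck unfolding increasable_def by (metis (no_types, lifting) converse_rtranclpE)
  moreover have "[1, 2] \<in> S" "[2, 1] \<in> S" by (auto simp: S_def)
  ultimately show "\<not> (\<exists>a \<in> S. \<forall>b \<in> S. increasable S b a)"
    by (metis list.inject numeral_eq_one_iff semiring_norm(85))
qed

end

theory Submission
  imports Defs
begin

text \<open>
  Read a string of \<open>S\<close> as an edge from its prefix to its suffix of length \<open>n - 1\<close>. Since \<open>S\<close>
  is closed under rotations, every vertex has equal in- and out-degree, so the greedy trail can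
  only stop by returning to \<open>\<alpha>\<close>, and its set \<open>V\<close> of strings is balanced at every vertex.

  \<open>V\<close> is closed under rotations: if \<open>a\<gamma> \<in> V\<close> but \<open>\<gamma>a \<notin> V\<close>, then balance at \<open>\<gamma>\<close> yields
  \<open>\<gamma>b \<in> V\<close> with \<open>b\<gamma> \<notin> V\<close>, and \<open>b < a\<close> because at \<open>\<gamma>\<close> the smaller symbols are used first.
  So \<open>\<gamma>b\<close> has smaller symbol sum and some rotation outside \<open>V\<close>, and one descends.
  As \<open>V\<close> is also closed under decreasing the last symbol, it contains every string that is
  increasable to a rotation of \<open>\<alpha>\<close>.

  Conversely, go backwards along the trail. If \<open>a\<gamma>\<close> is followed by \<open>\<gamma>c\<close>, then \<open>\<gamma>a \<in> V\<close>
  occurs either later than \<open>a\<gamma>\<close>, or no later, and then \<open>a \<le> c\<close> by greediness. In both cases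
  \<open>\<gamma>a\<close> is increasable to a rotation of \<open>\<alpha>\<close>, hence so is \<open>a\<gamma>\<close>.
\<close>

section \<open>Rotations\<close>

lemma rotate_in_closed: "closed_under_rotations S \<Longrightarrow> w \<in> S \<Longrightarrow> rotate i w \<in> S"
  by (auto simp: closed_under_rotations_def rotations_def)

lemma rotate1_in_closed: "closed_under_rotations S \<Longrightarrow> w \<in> S \<Longrightarrow> rotate1 w \<in> S"
  using rotate_in_closed[of S w 1] by simp

lemma rotate_in_rotations: "r \<in> rotations w \<Longrightarrow> rotate i r \<in> rotations w"
  by (auto simp: rotations_def rotate_rotate)

lemma rotate_pred_rotate1: "rotate (length w - 1) (rotate1 w) = w"
proof (cases w)
  case (Cons x xs)
  then show ?thesis using rotate_append[of xs "[x]"] by simp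
qed simp

lemma rotate1_eq_tl: "w \<noteq> [] \<Longrightarrow> rotate1 w = tl w @ [hd w]"
  by (cases w) auto

lemma sum_list_rotate1: "sum_list (rotate1 w) = sum_list (w :: nat list)"
  by (cases w) auto

lemma sum_list_rotate: "sum_list (rotate i w) = sum_list (w :: nat list)"
  by (induction i) (auto simp: sum_list_rotate1)

lemma increases_one_rotate1:
  assumes "increases_one d e"
  shows "increases_one (rotate1 d) (rotate1 e)"
proof -
  obtain i c where i: "i < length d" "d ! i < c" "e = d[i := c]"
    using assms by (auto simp: increases_one_def)
  then obtain x xs where d: "d = x # xs" by (cases d) auto
  show ?thesis
  proof (cases i)
    case 0
    then have "rotate1 e = (rotate1 d)[length xs := c]" "(rotate1 d) ! length xs < c"
      using i d by auto
    then show ?thesis unfolding increases_one_def using d by auto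
  next
    case (Suc i')
    then have "rotate1 e = (rotate1 d)[i' := c]" "(rotate1 d) ! i' < c"
      using i d by (auto simp: list_update_append nth_append)
    moreover have "i' < length (rotate1 d)" using d i Suc by simp
    ultimately show ?thesis unfolding increases_one_def by blast
  qed
qed

lemma increasable_rotate1:
  assumes S: "closed_under_rotations S" and "increasable S b a"
  shows "increasable S (rotate1 b) (rotate1 a)"
proof -
  have "(\<lambda>d e. e \<in> S \<and> increases_one d e)\<^sup>*\<^sup>* b a" "b \<in> S"
    using assms by (auto simp: increasable_def)
  then show ?thesis
  proof (induction rule: rtranclp_induct)
    case base
    then show ?case using rotate1_in_closed[OF S] by (auto simp: increasable_def)
  next
    case (step y z)
    then have "rotate1 z \<in> S \<and> increases_one (rotate1 y) (rotate1 z)"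
      using rotate1_in_closed[OF S] increases_one_rotate1 by blast
    with step show ?case by (auto simp: increasable_def intro: rtranclp.rtrancl_into_rtrancl)
  qed
qed

lemma increasable_rotate:
  "closed_under_rotations S \<Longrightarrow> increasable S b a \<Longrightarrow> increasable S (rotate i b) (rotate i a)"
  by (induction i) (auto intro: increasable_rotate1)

text \<open>Rotating the whole chain by \<open>length b - 1\<close> further places brings its start
  back to \<open>b\<close> and keeps its end a rotation of \<open>a\<close>.\<close>

lemma increasable_to_rotation_of_rotate1:
  assumes "closed_under_rotations S" "r \<in> rotations a" "increasable S (rotate1 b) r"
  shows "\<exists>r \<in> rotations a. increasable S b r"
  using increasable_rotate[OF assms(1,3), of "length b - 1"] rotate_in_rotations[OF assms(2)]
  unfolding rotate_pred_rotate1 by blast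

section \<open>Balance along trails\<close>

text \<open>For \<open>i < j\<close>, the string \<open>b i\<close> enters the vertex
  \<open>g\<close> exactly when \<open>b (Suc i)\<close> leaves it, so \<open>Suc\<close> matches
  entries with exits.\<close>

lemma card_butlast_eq_card_tl:
  assumes "\<And>i. i < j \<Longrightarrow> butlast (b (Suc i)) = tl (b i)"
  shows "card {i \<in> {1..j}. butlast (b i) = g} = card {i \<in> {..<j}. tl (b i) = g}"
proof -
  have "{i \<in> {1..j}. butlast (b i) = g} = Suc ` {i \<in> {..<j}. tl (b i) = g}"
  proof (intro set_eqI iffI)
    fix i assume i: "i \<in> {i \<in> {1..j}. butlast (b i) = g}"
    then have "i = Suc (i - 1)" "i - 1 < j" by auto
    with i assms[of "i - 1"] show "i \<in> Suc ` {i \<in> {..<j}. tl (b i) = g}" by auto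
  qed (use assms in auto)
  then show ?thesis by (simp add: card_image)
qed

text \<open>On a closed trail, index 0 can be traded for index \<open>m\<close>.\<close>

lemma card_lessThan_eq_card_atLeast1:
  fixes m :: nat
  assumes "P 0 \<longleftrightarrow> P m" and "m \<ge> 1"
  shows "card {i \<in> {..<m}. P i} = card {i \<in> {1..m}. P i}"
proof (rule bij_betw_same_card)
  show "bij_betw (\<lambda>i. if i = 0 then m else i) {i \<in> {..<m}. P i} {i \<in> {1..m}. P i}"
    by (rule bij_betw_byWitness[where f' = "\<lambda>i. if i = m then 0 else i"])
      (use assms in \<open>auto split: if_splits\<close>)
qed

section \<open>Closed greedy trails\<close>

text \<open>The least-symbol rule in abstract form, on a trail with \<open>b m = b 0\<close>. A
  string counts as used from index 1 on, since the start may be visited again.\<close>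

locale greedy_tour =
  fixes S :: "nat list set" and n :: nat and b :: "nat \<Rightarrow> nat list" and m :: nat
  assumes n: "n \<ge> 1"
    and length_S: "w \<in> S \<Longrightarrow> length w = n"
    and rot: "closed_under_rotations S"
    and m: "m \<ge> 1"
    and closed: "b 0 = b m"
    and inj: "inj_on b {1..m}"
    and b_in: "i \<le> m \<Longrightarrow> b i \<in> S"
    and b_step: "i < m \<Longrightarrow> b (Suc i) = tl (b i) @ [last (b (Suc i))]"
    and greedy: "i < m \<Longrightarrow> tl (b i) @ [c] \<in> S \<Longrightarrow> c < last (b (Suc i))
      \<Longrightarrow> tl (b i) @ [c] \<in> b ` {1..i}"
begin

section \<open>Closure of the visited strings under rotation and decrease\<close>

definition V :: "nat list set" where "V = b ` {1..m}"

lemma V_subset: "V \<subseteq> S"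
  using b_in by (auto simp: V_def)

lemma finite_V: "finite V"
  by (simp add: V_def)

lemma S_nonempty_string: "w \<in> S \<Longrightarrow> w \<noteq> []"
  using length_S n by fastforce

lemma butlast_b: "i < m \<Longrightarrow> butlast (b (Suc i)) = tl (b i)"
  by (subst b_step) auto

lemma V_balanced: "card {e \<in> V. butlast e = g} = card {e \<in> V. tl e = g}"
proof -
  have *: "card {e \<in> V. P e} = card {i \<in> {1..m}. P (b i)}" for P
  proof -
    have "{e \<in> V. P e} = b ` {i \<in> {1..m}. P (b i)}" by (auto simp: V_def)
    moreover have "inj_on b {i \<in> {1..m}. P (b i)}" by (rule inj_on_subset[OF inj]) auto
    ultimately show ?thesis by (simp add: card_image)
  qed
  show ?thesis
    unfolding * using card_butlast_eq_card_tl[of m b g, OF butlast_b]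
      card_lessThan_eq_card_atLeast1[of "\<lambda>i. tl (b i) = g" m] closed m by simp
qed

text \<open>When the trail took \<open>c\<close> at the vertex \<open>g\<close>, the smaller symbol
  \<open>c'\<close> had already been used there.\<close>

lemma V_decrease_last:
  assumes "g @ [c] \<in> V" "c' < c" "g @ [c'] \<in> S"
  shows "g @ [c'] \<in> V"
proof -
  obtain i where i: "i < m" "g @ [c] = b (Suc i)"
  proof -
    obtain j where "j \<in> {1..m}" "g @ [c] = b j" using assms(1) by (auto simp: V_def)
    then show thesis using that[of "j - 1"] by auto
  qed
  then have "g = tl (b i)" "c = last (b (Suc i))"
    using butlast_b[of i] by (metis butlast_snoc, metis last_snoc)
  then have "g @ [c'] \<in> b ` {1..i}" using greedy[OF i(1), of c'] assms by simp
  then show ?thesis using i(1) by (auto simp: V_def)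
qed

lemma V_rotate1: "e \<in> V \<Longrightarrow> rotate1 e \<in> V"
proof (induction "sum_list e" arbitrary: e rule: less_induct)
  case less
  show ?case
  proof (rule ccontr)
    assume notin: "rotate1 e \<notin> V"
    have eS: "e \<in> S" using less.prems V_subset by auto
    obtain a g where e: "e = a # g" using S_nonempty_string[OF eS] by (cases e) auto
    let ?X = "{e \<in> V. tl e = g}" and ?Y = "{e \<in> V. butlast e = g}"
    have fin: "finite ?X" "finite ?Y" using finite_V by auto
    \<comment> \<open>\<open>?X\<close> holds the visited strings entering \<open>g\<close>,
      \<open>?Y\<close> those leaving it. They are equally many, so the inclusion would be an
      equality and put \<open>rotate1 e\<close> into \<open>V\<close>.\<close>
    have "\<not> ?Y \<subseteq> rotate1 ` ?X"
    proof
      assume sub: "?Y \<subseteq> rotate1 ` ?X"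
      have "card (rotate1 ` ?X) \<le> card ?Y"
        using card_image_le[OF fin(1), of rotate1] V_balanced[of g] by simp
      then have "?Y = rotate1 ` ?X" using card_seteq[of "rotate1 ` ?X" ?Y] sub fin by simp
      moreover have "rotate1 e \<in> rotate1 ` ?X" by (rule imageI) (use less.prems e in simp)
      ultimately show False using notin by blast
    qed
    then obtain f where f: "f \<in> V" "butlast f = g" "f \<notin> rotate1 ` ?X" by auto
    define x where "x = last f"
    have fx: "f = g @ [x]" using f S_nonempty_string[of f] V_subset
      unfolding x_def by (metis append_butlast_last_id subsetD)
    have xg: "x # g \<notin> V" using f(3) fx by force
    have gaS: "g @ [a] \<in> S" using rotate1_in_closed[OF rot eS] e by simp
    have "x \<noteq> a" using notin e f(1) fx by auto
    moreover have "\<not> a < x" using V_decrease_last[of g x a] f(1) fx gaS notin e by auto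
    ultimately have "sum_list f < sum_list e" using fx e by simp
    \<comment> \<open>Every rotation of \<open>f\<close> has the symbol sum of \<open>f\<close>, so
      the induction hypothesis applies along the whole orbit, which contains
      \<open>x # g\<close>.\<close>
    then have "rotate i f \<in> V" for i
      by (induction i) (use f(1) less.hyps in \<open>auto simp: sum_list_rotate\<close>)
    from this[of "length g"] show False using fx xg by (simp add: rotate_append)
  qed
qed

lemma V_rotate: "e \<in> V \<Longrightarrow> rotate i e \<in> V"
  by (induction i) (auto intro: V_rotate1)

text \<open>Rotating the changed symbol to the last place reduces the claim to
  \<open>V_decrease_last\<close>.\<close>

lemma V_decrease:
  assumes "e \<in> V" "d \<in> S" "increases_one d e"
  shows "d \<in> V"
proof -
  obtain i c where i: "i < length d" "d ! i < c" "e = d[i := c]"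
    using assms by (auto simp: increases_one_def)
  define u v where "u = take i d" and "v = drop (Suc i) d"
  have d: "d = (u @ [d ! i]) @ v" using i(1) by (simp add: u_def v_def id_take_nth_drop)
  have e: "e = (u @ [c]) @ v" using i by (simp add: u_def v_def upd_conv_take_nth_drop)
  have "(v @ u) @ [c] \<in> V"
    using V_rotate[OF assms(1), of "length (u @ [c])"] rotate_append[of "u @ [c]" v] e by simp
  moreover have "(v @ u) @ [d ! i] \<in> S"
    using rotate_in_closed[OF rot assms(2), of "length (u @ [d ! i])"]
      rotate_append[of "u @ [d ! i]" v] d by simp
  ultimately have "v @ (u @ [d ! i]) \<in> V" using V_decrease_last[of "v @ u" c "d ! i"] i(2) by simp
  from V_rotate[OF this, of "length v"] show ?thesis
    using rotate_append[of v "u @ [d ! i]"] d by simp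
qed

section \<open>Visited strings and increasability\<close>

lemma start_in_V: "b 0 \<in> V"
  using closed m by (auto simp: V_def)

lemma increasable_imp_in_V:
  assumes "r \<in> rotations (b 0)" "increasable S e r"
  shows "e \<in> V"
proof -
  have "(\<lambda>d e. e \<in> S \<and> increases_one d e)\<^sup>*\<^sup>* e r" "e \<in> S"
    using assms(2) by (auto simp: increasable_def)
  moreover have "r \<in> V" using assms(1) V_rotate[OF start_in_V] by (auto simp: rotations_def)
  ultimately show ?thesis
    by (induction rule: converse_rtranclp_induct) (auto intro: V_decrease)
qed

lemma increasable_b:
  "i \<le> m \<Longrightarrow> i \<ge> 1 \<Longrightarrow> \<exists>r \<in> rotations (b 0). increasable S (b i) r"
proof (induction "m - i" arbitrary: i rule: less_induct)
  case less
  show ?case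
  proof (cases "i = m")
    case True
    have "rotate 0 (b 0) \<in> rotations (b 0)" unfolding rotations_def by blast
    then show ?thesis using True closed b_in[of m]
      by (intro bexI[of _ "b 0"]) (auto simp: increasable_def)
  next
    case False
    then have im: "i < m" using less.prems by simp
    have later: "\<exists>r \<in> rotations (b 0). increasable S (b j) r" if "i < j" "j \<le> m" for j
      using less.hyps[of j] that less.prems by auto
    have bi: "b i \<in> S" "b i \<noteq> []" using b_in[of i] S_nonempty_string less.prems by auto
    define a c where "a = hd (b i)" and "c = last (b (Suc i))"
    have rot1: "rotate1 (b i) = tl (b i) @ [a]" using rotate1_eq_tl bi by (simp add: a_def)
    have next_b: "b (Suc i) = tl (b i) @ [c]" using b_step[OF im] by (simp add: c_def)
    have inS: "rotate1 (b i) \<in> S" using rotate1_in_closed[OF rot bi(1)] .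
    have "rotate1 (b i) \<in> V" using V_rotate1 less.prems by (auto simp: V_def)
    then obtain j where j: "j \<in> {1..m}" "rotate1 (b i) = b j" by (auto simp: V_def)
    have "\<exists>r \<in> rotations (b 0). increasable S (rotate1 (b i)) r"
    proof (cases "i < j")
      case True
      then show ?thesis using later[of j] j by auto
    next
      case False
      obtain j' where j': "j = Suc j'" "j' < m" using j(1) by (cases j) auto
      have "tl (b j') = tl (b i)" using butlast_b[OF j'(2)] j j' rot1 by (metis butlast_snoc)
      moreover have "last (b (Suc j')) = a" using j j' rot1 by (metis last_snoc)
      \<comment> \<open>Here \<open>j \<le> i\<close>, so \<open>b (Suc i)\<close> comes later than
        \<open>b j\<close>. Thus \<open>c\<close> was still free when \<open>a\<close> was chosen,
        and greediness forces \<open>a \<le> c\<close>.\<close>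
      moreover have "b (Suc i) \<notin> b ` {1..j'}"
      proof
        assume "b (Suc i) \<in> b ` {1..j'}"
        then obtain l where "l \<in> {1..j'}" "b (Suc i) = b l" by auto
        then show False using inj_onD[OF inj, of "Suc i" l] im False j' by auto
      qed
      ultimately have "\<not> c < a" using greedy[OF j'(2), of c] next_b b_in[of "Suc i"] im by auto
      then have ac: "a \<le> c" by simp
      obtain r where r: "r \<in> rotations (b 0)" "increasable S (b (Suc i)) r"
        using later[of "Suc i"] im by auto
      show ?thesis
      proof (cases "a = c")
        case True
        then show ?thesis using r rot1 next_b by auto
      next
        case False
        then have "increases_one (rotate1 (b i)) (b (Suc i))"
          unfolding increases_one_def rot1 next_b using ac
          by (intro exI[of _ "length (tl (b i))"] exI[of _ c] conjI)
            (auto simp del: length_tl simp: nth_append list_update_append)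
        then have "increasable S (rotate1 (b i)) r"
          using r(2) inS unfolding increasable_def
          by (auto intro: converse_rtranclp_into_rtranclp)
        then show ?thesis using r(1) by auto
      qed
    qed
    then show ?thesis using increasable_to_rotation_of_rotate1[OF rot] by blast
  qed
qed

lemma in_V_iff: "e \<in> V \<longleftrightarrow> (\<exists>r \<in> rotations (b 0). increasable S e r)"
  using increasable_imp_in_V increasable_b by (auto simp: V_def)

section \<open>Cyclic windows of the word read off the trail\<close>

definition tour_word :: "nat list" where "tour_word = map (\<lambda>i. last (b (Suc i))) [0..<m]"

lemma length_tour_word: "length tour_word = m"
  by (simp add: tour_word_def)

lemma b_mod_Suc:
  "b (Suc i mod m) = tl (b (i mod m)) @ [tour_word ! (i mod m)]"
proof -
  have lt: "i mod m < m" using m by simp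
  have "b (Suc i mod m) = b (Suc (i mod m))"
    using closed by (auto simp: mod_Suc)
  then show ?thesis using b_step[OF lt] lt by (simp add: tour_word_def)
qed

text \<open>Each step drops the first symbol and appends the next symbol of the word; for
  \<open>t \<le> n\<close> only symbols of \<open>b (i mod m)\<close> have been dropped.\<close>

lemma b_mod_add:
  "t \<le> n \<Longrightarrow> b ((i + t) mod m) = drop t (b (i mod m)) @ map (\<lambda>j. tour_word ! ((i + j) mod m)) [0..<t]"
proof (induction t)
  case (Suc t)
  have "length (b (i mod m)) = n" using length_S b_in[of "i mod m"] m by simp
  then have "drop t (b (i mod m)) \<noteq> []" using Suc.prems by simp
  then show ?case using Suc b_mod_Suc[of "i + t"] by (simp add: tl_drop drop_Suc)
qed simp

text \<open>After \<open>n\<close> steps no symbol of the old string remains. This covers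
  \<open>m < n\<close>, where the window wraps around, because all indices are taken modulo
  \<open>m\<close>.\<close>

lemma cyclic_window_tour_word: "cyclic_window n tour_word i = b ((i + n) mod m)"
proof -
  have "length (b (i mod m)) = n" using length_S b_in[of "i mod m"] m by simp
  then show ?thesis using b_mod_add[of n i]
    by (simp add: cyclic_window_def length_tour_word)
qed

text \<open>The window map is the shift by \<open>n\<close> modulo \<open>m\<close>, a permutation
  of the indices, followed by \<open>b\<close>.\<close>

lemma bij_betw_cyclic_window: "bij_betw (cyclic_window n tour_word) {..<m} V"
proof -
  have "inj_on b {..<m}"
  proof (rule inj_onI)
    fix i j assume ij: "i \<in> {..<m}" "j \<in> {..<m}" "b i = b j"
    \<comment> \<open>Injectivity is given on \<open>{1..m}\<close>, so index 0 is replaced by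
      \<open>m\<close>.\<close>
    then have "b (if i = 0 then m else i) = b (if j = 0 then m else j)" using closed by auto
    then have "(if i = 0 then m else i) = (if j = 0 then m else j)"
      by (rule inj_onD[OF inj]) (use ij m in auto)
    then show "i = j" using ij by (auto split: if_splits)
  qed
  moreover have inj_shift: "inj_on (\<lambda>i. (i + n) mod m) {..<m}"
  proof (rule linorder_inj_onI')
    fix i j assume ij: "i \<in> {..<m}" "j \<in> {..<m}" "i < j"
    show "(i + n) mod m \<noteq> (j + n) mod m"
    proof
      assume "(i + n) mod m = (j + n) mod m"
      then have "m dvd (j + n) - (i + n)" using ij by (metis mod_eq_dvd_iff_nat add_le_mono1 less_imp_le)
      then show False using ij by (auto dest: dvd_imp_le)
    qed
  qed
  moreover have "(\<lambda>i. (i + n) mod m) ` {..<m} = {..<m}"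
    by (rule endo_inj_surj[OF _ _ inj_shift]) (use m in auto)
  ultimately have "bij_betw (b \<circ> (\<lambda>i. (i + n) mod m)) {..<m} (b ` {..<m})"
    by (intro bij_betw_trans[of _ _ "{..<m}"]) (auto simp: bij_betw_def)
  moreover have "b ` {..<m} = V"
  proof (intro set_eqI iffI)
    fix e assume "e \<in> b ` {..<m}"
    then obtain i where "i < m" "e = b i" by auto
    then show "e \<in> V" using start_in_V by (cases i) (auto simp: V_def)
  next
    fix e assume "e \<in> V"
    then obtain i where i: "1 \<le> i" "i \<le> m" "e = b i" by (auto simp: V_def)
    show "e \<in> b ` {..<m}"
    proof (cases "i = m")
      case True
      then show ?thesis using i closed m by (auto intro!: image_eqI[of _ _ 0])
    qed (use i in auto)
  qed
  ultimately show ?thesis by (simp add: cyclic_window_tour_word[abs_def] comp_def)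
qed

lemma cyclic_substring_tour_word_iff:
  assumes "e \<in> S"
  shows "cyclic_substring e tour_word \<longleftrightarrow> e \<in> V"
proof -
  have V: "V = cyclic_window n tour_word ` {..<m}"
    using bij_betw_cyclic_window by (simp add: bij_betw_def)
  show ?thesis
    unfolding cyclic_substring_def length_tour_word length_S[OF assms] V image_iff
    by (auto simp: eq_commute)
qed

text \<open>The \<open>m\<close> windows are always distinct strings of \<open>S\<close>, so being a
  universal cycle amounts to covering \<open>S\<close>.\<close>

lemma universal_cycle_tour_word_iff:
  "universal_cycle n S tour_word \<longleftrightarrow> (\<forall>e \<in> S. e \<in> V)"
proof
  assume u: "universal_cycle n S tour_word"
  show "\<forall>e \<in> S. e \<in> V"
  proof
    fix e assume e: "e \<in> S"
    then show "e \<in> V" using u length_S[OF e] cyclic_substring_tour_word_iff[OF e]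
      by (auto simp: universal_cycle_def cyclic_substring_def)
  qed
next
  assume "\<forall>e \<in> S. e \<in> V"
  then have SV: "S = V" using V_subset by auto
  have "card S = m" using bij_betw_same_card[OF bij_betw_cyclic_window] SV by simp
  moreover have "\<exists>!i. i < m \<and> cyclic_window n tour_word i = e" if "e \<in> S" for e
  proof -
    have inj': "inj_on (cyclic_window n tour_word) {..<m}"
      and "e \<in> cyclic_window n tour_word ` {..<m}"
      using bij_betw_cyclic_window that unfolding SV by (auto simp: bij_betw_def)
    then obtain i where i: "i \<in> {..<m}" "cyclic_window n tour_word i = e" by (elim imageE) simp
    show ?thesis
    proof (rule ex1I[of _ i])
      show "i < m \<and> cyclic_window n tour_word i = e" using i by simp
      fix j assume "j < m \<and> cyclic_window n tour_word j = e"
      then show "j = i" using inj_onD[OF inj', of j i] i by simp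
    qed
  qed
  ultimately show "universal_cycle n S tour_word"
    by (simp add: universal_cycle_def length_tour_word)
qed

end

section \<open>The greedy construction closes up\<close>

locale greedy_start =
  fixes n k :: nat and S :: "nat list set" and a :: "nat list"
  assumes n: "n \<ge> 1"
    and S_strings: "S \<subseteq> strings n k"
    and rot: "closed_under_rotations S"
    and a: "a \<in> S"
begin

definition b :: "nat \<Rightarrow> nat list" where "b j = last (greedy_run k S a j)"

definition m :: nat where "m = (LEAST m. greedy_halted k S (greedy_run k S a m))"

abbreviation choices :: "nat \<Rightarrow> nat set" where "choices j \<equiv> greedy_choices k S (greedy_run k S a j)"

lemma length_S: "w \<in> S \<Longrightarrow> length w = n"
  using S_strings by (auto simp: strings_def)

lemma finite_S: "finite S"
  by (rule finite_subset[OF S_strings])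
    (use finite_lists_length_eq[of "{1..k}" n] in \<open>simp add: strings_def conj_commute\<close>)

lemma b_0: "b 0 = a"
  by (simp add: b_def)

lemma greedy_run_eq: "greedy_run k S a j = map b [0..<Suc j]"
proof (induction j)
  case (Suc j)
  have "greedy_run k S a (Suc j) = greedy_run k S a j @ [b (Suc j)]"
    by (simp add: b_def greedy_step_def)
  then show ?case using Suc by simp
qed (simp add: b_def)

lemma set_tl_run: "set (tl (greedy_run k S a j)) = b ` {1..j}"
proof -
  have "tl (greedy_run k S a j) = map b [1..<Suc j]"
    unfolding greedy_run_eq by (simp add: map_tl[symmetric] tl_upt del: upt_Suc)
  then show ?thesis by (simp add: atLeastLessThanSuc_atLeastAtMost del: upt_Suc)
qed

text \<open>Membership in \<open>S \<subseteq> strings n k\<close> forces \<open>c\<close> into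
  \<open>{1..k}\<close>.\<close>

lemma choices_iff: "c \<in> choices j \<longleftrightarrow> tl (b j) @ [c] \<in> S \<and> tl (b j) @ [c] \<notin> b ` {1..j}"
  unfolding greedy_choices_def set_tl_run using S_strings by (auto simp: b_def strings_def)

lemma halted_iff:
  "greedy_halted k S (greedy_run k S a j) \<longleftrightarrow> (j \<ge> 1 \<and> b j = a) \<or> choices j = {}"
proof -
  have "hd (greedy_run k S a j) = a" 
    by (simp add: greedy_run_eq hd_map b_0 del: upt_Suc greedy_run.simps)
  moreover have "length (greedy_run k S a j) = Suc j" by (simp add: greedy_run_eq)
  ultimately show ?thesis by (auto simp: greedy_halted_def b_def)
qed

lemma b_Suc: "b (Suc j) = tl (b j) @ [LEAST c. c \<in> choices j]"
  by (simp add: b_def greedy_step_def)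

lemma least_choice:
  assumes "choices j \<noteq> {}"
  shows "b (Suc j) \<in> S" "b (Suc j) \<notin> b ` {1..j}"
    "tl (b j) @ [c] \<in> S \<Longrightarrow> c < last (b (Suc j)) \<Longrightarrow> tl (b j) @ [c] \<in> b ` {1..j}"
proof -
  have "(LEAST c. c \<in> choices j) \<in> choices j" using assms by (metis LeastI ex_in_conv)
  then show "b (Suc j) \<in> S" "b (Suc j) \<notin> b ` {1..j}" unfolding choices_iff b_Suc by auto
  assume "tl (b j) @ [c] \<in> S" "c < last (b (Suc j))"
  then show "tl (b j) @ [c] \<in> b ` {1..j}"
    using not_less_Least[of c "\<lambda>c. c \<in> choices j"] choices_iff by (auto simp: b_Suc)
qed

lemma distinct_prefix:
  assumes "\<And>i. i < j \<Longrightarrow> choices i \<noteq> {}"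
  shows "inj_on b {1..j} \<and> b ` {0..j} \<subseteq> S"
  using assms
proof (induction j)
  case (Suc j)
  have "{1..Suc j} = insert (Suc j) {1..j}" "{0..Suc j} = insert (Suc j) {0..j}" by auto
  then show ?case using Suc least_choice[of j] by auto
qed (use a b_0 in auto)

text \<open>Otherwise the strings from \<open>b 1\<close> to \<open>b (card S + 1)\<close> would be
  distinct elements of \<open>S\<close>.\<close>

lemma halts: "\<exists>j. greedy_halted k S (greedy_run k S a j)"
proof (rule ccontr)
  assume "\<not> ?thesis"
  then have "choices i \<noteq> {}" for i using halted_iff by blast
  then have "inj_on b {1..Suc (card S)}" "b ` {1..Suc (card S)} \<subseteq> S"
    using distinct_prefix[of "Suc (card S)"] by (auto simp: image_subset_iff)
  then have "card {1..Suc (card S)} \<le> card S" using card_inj_on_le finite_S by blast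
  then show False by simp
qed

lemma not_halted_before:
  assumes "i < m"
  shows "choices i \<noteq> {}" "i \<ge> 1 \<Longrightarrow> b i \<noteq> a"
  using not_less_Least[OF assms[unfolded m_def]] halted_iff by auto

lemma prefix_m: "inj_on b {1..m}" "i \<le> m \<Longrightarrow> b i \<in> S"
  using distinct_prefix[of m] not_halted_before(1) by auto

text \<open>
  If the trail were stuck at \<open>tl (b m)\<close> without having met \<open>a\<close> again, the \<open>b i\<close> with
  \<open>i \<le> m\<close> entering this vertex would be distinct and outnumber its out-edges by one.
\<close>

lemma returns: "m \<ge> 1 \<and> b m = a"
proof (rule ccontr)
  assume neg: "\<not> ?thesis"
  have "greedy_halted k S (greedy_run k S a m)"
    unfolding m_def using halts by (rule LeastI_ex)
  then have stuck: "choices m = {}" using neg halted_iff by auto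
  define g where "g = tl (b m)"
  have nonempty: "w \<in> S \<Longrightarrow> w \<noteq> []" for w using length_S n by fastforce
  let ?X = "{e \<in> S. tl e = g}" and ?Y = "{e \<in> S. butlast e = g}"
  let ?I = "{i \<in> {1..m}. butlast (b i) = g}" and ?J = "{i \<in> {..m}. tl (b i) = g}"
  \<comment> \<open>As \<open>a\<close> is not met again, index 0 can be included.\<close>
  have inj0: "inj_on b {..m}"
  proof -
    have "a \<notin> b ` {1..m}"
    proof
      assume "a \<in> b ` {1..m}"
      then obtain i where "1 \<le> i" "i \<le> m" "b i = a" by auto
      then show False using not_halted_before(2)[of i] neg by (cases "i = m") auto
    qed
    moreover have "{..m} = insert 0 {1..m}" by auto
    ultimately show ?thesis using prefix_m(1) b_0 by simp
  qed
  \<comment> \<open>With no choice left, every string of \<open>S\<close> leaving \<open>g\<close>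
    is already on the trail.\<close>
  have "?Y \<subseteq> b ` ?I"
  proof
    fix e assume e: "e \<in> ?Y"
    then have eq: "e = g @ [last e]" using nonempty[of e] append_butlast_last_id by auto
    have "last e \<notin> choices m" using stuck by simp
    then have "e \<in> b ` {1..m}" using choices_iff eq e unfolding g_def by auto
    then show "e \<in> b ` ?I" using e by auto
  qed
  moreover have "b ` ?I \<subseteq> ?Y" using prefix_m(2) by auto
  ultimately have "?Y = b ` ?I" by (rule subset_antisym)
  then have "card ?Y = card (b ` ?I)" by (rule arg_cong)
  also have "\<dots> = card ?I" by (rule card_image) (rule inj_on_subset[OF inj0], auto)
  also have "\<dots> = card {i \<in> {..<m}. tl (b i) = g}"
    by (rule card_butlast_eq_card_tl) (simp add: b_Suc)
  \<comment> \<open>Strictness comes from index \<open>m\<close>, where the trail enters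
    \<open>g\<close> without leaving it.\<close>
  also have "\<dots> < card ?J"
    by (rule psubset_card_mono) (auto simp: g_def)
  also have "\<dots> \<le> card ?X"
    by (rule card_inj_on_le[of b]) (use inj0 prefix_m(2) finite_S in \<open>auto intro: inj_on_subset\<close>)
  \<comment> \<open>\<open>rotate1\<close> sends the strings of \<open>S\<close> entering
    \<open>g\<close> injectively to strings of \<open>S\<close> leaving it.\<close>
  also have "\<dots> \<le> card ?Y"
  proof (rule card_inj_on_le[of rotate1])
    show "inj_on rotate1 ?X"
      by (rule inj_on_inverseI[of _ "rotate (n - 1)"])
        (use rotate_pred_rotate1 length_S in auto)
    show "rotate1 ` ?X \<subseteq> ?Y"
      using rotate1_in_closed[OF rot] nonempty by (auto simp: rotate1_eq_tl)
    show "finite ?Y" using finite_S by simp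
  qed
  finally show False by simp
qed

section \<open>The greedy string as the word of a closed trail\<close>

sublocale greedy_tour S n b m
proof
  show "b 0 = b m" "1 \<le> m" using returns b_0 by auto
  show "b (Suc i) = tl (b i) @ [last (b (Suc i))]" for i by (simp add: b_Suc)
  show "tl (b i) @ [c] \<in> b ` {1..i}"
    if "i < m" "tl (b i) @ [c] \<in> S" "c < last (b (Suc i))" for i c
    using least_choice(3) not_halted_before(1) that by blast
qed (use n length_S rot prefix_m in auto)

lemma greedy_eq_tour_word: "greedy k S a = tour_word"
proof -
  have "tl (greedy_run k S a m) = map b (map Suc [0..<m])"
    unfolding greedy_run_eq by (simp add: map_tl[symmetric] tl_upt map_Suc_upt del: upt_Suc)
  then show ?thesis by (simp add: greedy_def m_def[symmetric] tour_word_def)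
qed

lemma cyclic_substring_greedy_iff:
  "e \<in> S \<Longrightarrow> cyclic_substring e (greedy k S a) \<longleftrightarrow> (\<exists>r \<in> rotations a. increasable S e r)"
  using cyclic_substring_tour_word_iff in_V_iff by (simp add: greedy_eq_tour_word b_0)

lemma universal_cycle_greedy_iff:
  "universal_cycle n S (greedy k S a) \<longleftrightarrow> (\<forall>e \<in> S. \<exists>r \<in> rotations a. increasable S e r)"
  using universal_cycle_tour_word_iff in_V_iff by (simp add: greedy_eq_tour_word b_0)

end

text \<open>The second equivalence asks for a bound up to rotation: the class {12, 21} has a greedy
  universal cycle, but neither of its strings can be increased to the other.\<close>

theorem theorem1:
  fixes n k :: nat and S :: "nat list set"
  assumes "n \<ge> 1" and "k \<ge> 1"
    and "S \<subseteq> strings n k"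
    and "closed_under_rotations S"
  shows "(\<forall>\<alpha> \<in> S. \<forall>\<beta> \<in> S.
            cyclic_substring \<beta> (greedy k S \<alpha>) \<longleftrightarrow> (\<exists>\<rho> \<in> rotations \<alpha>. increasable S \<beta> \<rho>))
       \<and> (S \<noteq> {} \<longrightarrow>
            ((\<exists>\<alpha> \<in> S. universal_cycle n S (greedy k S \<alpha>)) \<longleftrightarrow>
             (\<exists>\<alpha> \<in> S. \<forall>\<beta> \<in> S. \<exists>\<rho> \<in> rotations \<alpha>. increasable S \<beta> \<rho>)))"
proof -
  have "greedy_start n k S \<alpha>" if "\<alpha> \<in> S" for \<alpha>
    using assms that by unfold_locales
  then show ?thesis
    using greedy_start.cyclic_substring_greedy_iff greedy_start.universal_cycle_greedy_iff
    by blast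
qed

end
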